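(* Let $q=q_1q_2\cdots q_k$ be a skew indecomposable pattern such that at least one of the following conditions holds: (1) $q_1\neq 1$; or (2) $q_k\neq k$; or (3) $q_1=1$ and $q_k=k$, but $q$ is Wilf-equivalent to a skew indecomposable pattern in which the first entry is not $1$ or the last entry is not $k$. Then the inequality $$\mathrm{Av}_{n,\ell+1}(q)\leq \mathrm{Av}_{n,\ell}(q)$$ holds for all nonnegative integers $n$ and all positive integers $\ell$.
   Context: A permutation of length $n$ is written in one-line notation $p=p_1p_2\cdots p_n$ as an ordering of $1,2,\dots,n$. A pattern $q=q_1\cdots q_k$ is a permutation of length $k$. A permutation $p$ contains $q$ if there are indices $i_1<i_2<\cdots<i_k$ such that for all $r,s$, $p_{i_r}<p_{i_s}$ if and only if $q_r<q_s$; otherwise $p$ avoids $q$. $\mathrm{Av}_n(q)$ is the number of permutations of length $n$ that avoid $q$. A nonempty permutation $p$ is skew indecomposable if it cannot be cut into two nonempty parts (an initial segment and the remaining final segment) so that each entry before the cut is larger than each entry after the cut. Every permutation can be uniquely cut into nonempty skew indecomposable strings $s_1,s_2,\dots,s_\ell$ of consecutive entries such that each entry of $s_i$ is larger than each entry of $s_j$ whenever $i<j$; these strings are the skew blocks of $p$ (the empty permutation has $0$ skew blocks; a skew indecomposable permutation has exactly one). $\mathrm{Av}_{n,\ell}(q)$ is the number of $q$-avoiding permutations of length $n$ having exactly $\ell$ skew blocks. Two patterns $q$ and $q'$ (of the same length $k$) are Wilf-equivalent if $\mathrm{Av}_n(q)=\mathrm{Av}_n(q')$ for all $n\ge 1$.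 *)

theory Defs
  imports "HOL-Combinatorics.Multiset_Permutations"
begin

text \<open>
  A permutation of length \<open>n\<close> in one-line notation is a list in
  \<^term>\<open>permutations_of_set {1..n::nat}\<close>. Entries take the values \<open>1, \<dots>, n\<close>, whereas list
  positions are counted from \<open>0\<close>, so that \<open>p ! r\<close> is the entry usually written with index \<open>r + 1\<close>.
\<close>

definition contains_pattern :: "nat list \<Rightarrow> nat list \<Rightarrow> bool" where
  "contains_pattern p q \<longleftrightarrow>
     (\<exists>i :: nat \<Rightarrow> nat. strict_mono_on {..<length q} i \<and>
        (\<forall>r<length q. i r < length p) \<and>
        (\<forall>r<length q. \<forall>s<length q. p ! i r < p ! i s \<longleftrightarrow> q ! r < q ! s))"

abbreviation avoids_pattern :: "nat list \<Rightarrow> nat list \<Rightarrow> bool" where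
  "avoids_pattern p q \<equiv> \<not> contains_pattern p q"

definition Av :: "nat \<Rightarrow> nat list \<Rightarrow> nat" where
  "Av n q = card {p \<in> permutations_of_set {1..n}. avoids_pattern p q}"

definition entries_above :: "nat list \<Rightarrow> nat list \<Rightarrow> bool" where
  "entries_above s t \<longleftrightarrow> (\<forall>x\<in>set s. \<forall>y\<in>set t. y < x)"

text \<open>
  Stated for arbitrary strings, because a skew block of a permutation need not have
  an initial segment \<open>{1..m}\<close> as its set of entries.
\<close>

definition skew_indecomposable :: "nat list \<Rightarrow> bool" where
  "skew_indecomposable p \<longleftrightarrow>
     p \<noteq> [] \<and> \<not> (\<exists>s t. s \<noteq> [] \<and> t \<noteq> [] \<and> p = s @ t \<and> entries_above s t)"

definition is_skew_decomposition :: "nat list \<Rightarrow> nat list list \<Rightarrow> bool" where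
  "is_skew_decomposition p ss \<longleftrightarrow>
     concat ss = p \<and> (\<forall>s\<in>set ss. skew_indecomposable s) \<and> sorted_wrt entries_above ss"

lemma skew_decomposition_exists: "\<exists>ss. is_skew_decomposition p ss"
proof (induction p rule: length_induct)
  case (1 p)
  show ?case
  proof (cases "p = [] \<or> skew_indecomposable p")
    case True
    then have "is_skew_decomposition p (if p = [] then [] else [p])"
      by (auto simp: is_skew_decomposition_def)
    then show ?thesis by blast
  next
    case False
    then obtain s t where st: "s \<noteq> []" "t \<noteq> []" "p = s @ t" "entries_above s t"
      by (auto simp: skew_indecomposable_def)
    then obtain ss ts where "is_skew_decomposition s ss" "is_skew_decomposition t ts"
      using 1 by (metis add_less_cancel_left add_less_cancel_right length_append
          length_greater_0_conv add.left_neutral add.right_neutral)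
    with st have "is_skew_decomposition p (ss @ ts)"
      by (auto simp: is_skew_decomposition_def sorted_wrt_append entries_above_def)
    then show ?thesis by blast
  qed
qed

lemma skew_decomposition_first_block:
  assumes "is_skew_decomposition p (s # ss)" and "is_skew_decomposition p (t # ts)"
    and "t = s @ u"
  shows "u = []"
proof (rule ccontr)
  assume "u \<noteq> []"
  have "concat ss = u @ concat ts"
    using assms by (auto simp: is_skew_decomposition_def)
  then have "set u \<subseteq> (\<Union>x\<in>set ss. set x)"
    by (metis Un_upper1 set_append set_concat)
  then have "entries_above s u"
    using assms(1) by (fastforce simp: is_skew_decomposition_def entries_above_def)
  moreover have "s \<noteq> []" "skew_indecomposable t"
    using assms by (auto simp: is_skew_decomposition_def skew_indecomposable_def)
  ultimately show False
    using \<open>u \<noteq> []\<close> assms(3) by (auto simp: skew_indecomposable_def)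
qed

lemma skew_decomposition_unique:
  "is_skew_decomposition p ss \<Longrightarrow> is_skew_decomposition p ts \<Longrightarrow> ss = ts"
proof (induction ss arbitrary: p ts)
  case Nil
  then show ?case
    by (cases ts) (auto simp: is_skew_decomposition_def skew_indecomposable_def)
next
  case (Cons s ss)
  from Cons.prems obtain t ts' where ts: "ts = t # ts'"
    by (cases ts) (auto simp: is_skew_decomposition_def skew_indecomposable_def)
  have "s @ concat ss = t @ concat ts'"
    using Cons.prems ts by (simp add: is_skew_decomposition_def)
  then obtain u where "s = t @ u \<or> t = s @ u"
    by (auto simp: append_eq_append_conv2)
  then have st: "s = t"
    using skew_decomposition_first_block Cons.prems ts by (metis append_Nil2)
  have "is_skew_decomposition (concat ss) ss" "is_skew_decomposition (concat ss) ts'"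
    using Cons.prems ts st by (auto simp: is_skew_decomposition_def)
  then show ?case using Cons.IH ts st by blast
qed

lemma skew_decomposition_ex1: "\<exists>!ss. is_skew_decomposition p ss"
  using skew_decomposition_exists skew_decomposition_unique by blast

definition skew_blocks :: "nat list \<Rightarrow> nat list list" where
  "skew_blocks p = (THE ss. is_skew_decomposition p ss)"

definition Av_blocks :: "nat \<Rightarrow> nat \<Rightarrow> nat list \<Rightarrow> nat" where
  "Av_blocks n l q =
     card {p \<in> permutations_of_set {1..n}. avoids_pattern p q \<and> length (skew_blocks p) = l}"

definition wilf_equivalent :: "nat list \<Rightarrow> nat list \<Rightarrow> bool" where
  "wilf_equivalent q q' \<longleftrightarrow> length q = length q' \<and> (\<forall>n\<ge>1. Av n q = Av n q')"

end

theory Submission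
  imports Defs
begin

text \<open>
  A permutation avoids a skew indecomposable \<open>q\<close> iff each of its skew blocks does. Hence, if
  \<open>B\<close> is the generating function of the skew indecomposable avoiders, the permutations with \<open>l\<close>
  blocks are counted by \<open>B ^ l\<close> and all avoiders by \<open>1 / (1 - B)\<close>. So it suffices to show that
  \<open>B ^ 2 \<le> B\<close> coefficientwise, and the coefficients of \<open>B\<close> only depend on the Wilf class of \<open>q\<close>.

  For two blocks \<open>L\<close> and \<open>f # R\<close>, moving the entry \<open>f\<close> to the front gives the indecomposable
  \<open>f # L @ R\<close>, from which \<open>L\<close> is recovered as the first skew block of \<open>L @ R\<close>. If \<open>q\<close> does not start
  with \<open>1\<close>, this can create a copy of \<open>q\<close> only if \<open>q\<close> itself has the shape \<open>f # L @ R\<close> with \<open>L\<close> above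
  \<open>R\<close> and above \<open>f\<close>. The inverse and the reverse complement of \<open>q\<close> are Wilf-equivalent to
  \<open>q\<close>, and at least one of them starts with an entry other than \<open>1\<close> and is not of that shape.
\<close>

section \<open>Skew blocks and containment\<close>

lemma skew_blocks_decomposition: "is_skew_decomposition p (skew_blocks p)"
  unfolding skew_blocks_def by (rule theI') (rule skew_decomposition_ex1)

lemma skew_blocks_eqI: "is_skew_decomposition p ss \<Longrightarrow> skew_blocks p = ss"
  using skew_blocks_decomposition skew_decomposition_unique by blast

lemma skew_blocks_Nil [simp]: "skew_blocks [] = []"
  by (rule skew_blocks_eqI) (simp add: is_skew_decomposition_def)

lemma skew_blocks_eq_Nil_iff: "skew_blocks p = [] \<longleftrightarrow> p = []"
  using skew_blocks_decomposition[of p] by (auto simp: is_skew_decomposition_def)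

lemma length_skew_blocks_eq_1_iff: "length (skew_blocks p) = 1 \<longleftrightarrow> skew_indecomposable p"
proof
  assume "length (skew_blocks p) = 1"
  then obtain s where "skew_blocks p = [s]" by (auto simp: length_Suc_conv)
  with skew_blocks_decomposition[of p] show "skew_indecomposable p"
    by (auto simp: is_skew_decomposition_def)
next
  assume "skew_indecomposable p"
  then have "skew_blocks p = [p]"
    by (intro skew_blocks_eqI) (simp add: is_skew_decomposition_def)
  then show "length (skew_blocks p) = 1" by simp
qed

lemma skew_blocks_append:
  assumes "skew_indecomposable s" and "entries_above s t"
  shows "skew_blocks (s @ t) = s # skew_blocks t"
proof (rule skew_blocks_eqI)
  have t: "is_skew_decomposition t (skew_blocks t)" by (rule skew_blocks_decomposition)
  then have "set t = (\<Union>x\<in>set (skew_blocks t). set x)"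
    by (metis is_skew_decomposition_def set_concat)
  with t assms show "is_skew_decomposition (s @ t) (s # skew_blocks t)"
    by (auto simp: is_skew_decomposition_def entries_above_def)
qed

lemma skew_blocks_ConsE:
  assumes "skew_blocks p = s # ss"
  shows "p = s @ concat ss" "skew_indecomposable s" "entries_above s (concat ss)"
    "skew_blocks (concat ss) = ss"
proof -
  have p: "is_skew_decomposition p (s # ss)"
    using skew_blocks_decomposition[of p] assms by simp
  then show "p = s @ concat ss" "skew_indecomposable s" "entries_above s (concat ss)"
    by (auto simp: is_skew_decomposition_def entries_above_def)
  from p show "skew_blocks (concat ss) = ss"
    by (intro skew_blocks_eqI) (auto simp: is_skew_decomposition_def)
qed

text \<open>\<open>S\<close> and \<open>T\<close> are arbitrary sets of positions, because
  occurrences of a pattern and point sets supply cuts in this form. If both are nonempty, then, all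
  of \<open>S\<close> preceding all of \<open>T\<close>, the list is cut at
  \<open>Min T\<close>.\<close>

lemma skew_indecomposable_index:
  assumes "skew_indecomposable q" "S \<union> T = {..<length q}"
    and less: "\<And>r s. r \<in> S \<Longrightarrow> s \<in> T \<Longrightarrow> r < s \<and> q ! s < q ! r"
  shows "S = {} \<or> T = {}"
proof (rule ccontr)
  assume "\<not> ?thesis"
  then have ne: "S \<noteq> {}" "T \<noteq> {}" by auto
  have fin: "finite S" "finite T"
    using assms(2) by (metis finite_Un finite_lessThan)+
  define c where "c = Min T"
  have c: "c \<in> T" using fin ne c_def by auto
  have clt: "c < length q" using c assms(2) by blast
  have S: "r \<in> S \<longleftrightarrow> r < c" if "r < length q" for r
  proof -
    have "r < c" if "r \<in> S" using less that c by blast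
    moreover have "r \<in> S" if "r < c"
    proof -
      have "r \<notin> T" using that fin c_def by (metis Min_le leD)
      then show ?thesis using assms(2) that clt by (metis Un_iff lessThan_iff less_trans)
    qed
    ultimately show ?thesis by blast
  qed
  have T: "r \<in> T" if "r < length q" "c \<le> r" for r
    using S[of r] that assms(2) by auto
  have "0 < c" using ne(1) less c by fastforce
  then have "take c q \<noteq> []" "drop c q \<noteq> []" "q = take c q @ drop c q"
    using clt by auto
  moreover have "entries_above (take c q) (drop c q)"
    unfolding entries_above_def
  proof (intro ballI)
    fix x y assume "x \<in> set (take c q)" "y \<in> set (drop c q)"
    then obtain r s where "r < c" "x = q ! r" "s < length q - c" "y = q ! (c + s)"
      using clt by (auto simp: in_set_conv_nth)
    then show "y < x" using less[of r "c + s"] S[of r] T[of "c + s"] clt by auto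
  qed
  ultimately show False using assms(1) unfolding skew_indecomposable_def by blast
qed

text \<open>An occurrence survives when its positions beyond \<open>u\<close> move by
  \<open>length w\<close>. With \<open>u\<close> or \<open>v\<close> empty this covers prefixes and
  suffixes; with \<open>w\<close> a single entry it restores a deleted entry.\<close>

lemma contains_pattern_insert:
  assumes "contains_pattern (u @ v) q"
  shows "contains_pattern (u @ w @ v) q"
proof -
  from assms obtain i where i: "strict_mono_on {..<length q} i"
      "\<And>r. r < length q \<Longrightarrow> i r < length (u @ v)"
      "\<And>r s. r < length q \<Longrightarrow> s < length q \<Longrightarrow> (u @ v) ! i r < (u @ v) ! i s \<longleftrightarrow> q ! r < q ! s"
    unfolding contains_pattern_def by blast
  define j where "j r = (if i r < length u then i r else i r + length w)" for r
  have nth: "(u @ w @ v) ! j r = (u @ v) ! i r" for r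
    by (auto simp: j_def nth_append)
  have "strict_mono_on {..<length q} j"
    using i(1) by (fastforce simp: strict_mono_on_def j_def)
  moreover have "j r < length (u @ w @ v)" if "r < length q" for r
    using i(2)[OF that] by (auto simp: j_def)
  ultimately show ?thesis
    unfolding contains_pattern_def using nth i(3) by metis
qed

text \<open>The positions of \<open>q\<close> sent into \<open>s\<close> and those sent into
  \<open>t\<close> satisfy the hypotheses of \<open>skew_indecomposable_index\<close>, so an
  occurrence cannot use both parts.\<close>

lemma contains_pattern_appendD:
  assumes q: "skew_indecomposable q" and st: "entries_above s t"
    and "contains_pattern (s @ t) q"
  shows "contains_pattern s q \<or> contains_pattern t q"
proof -
  from assms(3) obtain i where i: "strict_mono_on {..<length q} i"
      "\<And>r. r < length q \<Longrightarrow> i r < length (s @ t)"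
      "\<And>r s'. r < length q \<Longrightarrow> s' < length q \<Longrightarrow> (s @ t) ! i r < (s @ t) ! i s' \<longleftrightarrow> q ! r < q ! s'"
    unfolding contains_pattern_def by blast
  define S where "S = {r. r < length q \<and> i r < length s}"
  define T where "T = {r. r < length q \<and> length s \<le> i r}"
  have "S = {} \<or> T = {}"
  proof (rule skew_indecomposable_index[OF q])
    show "S \<union> T = {..<length q}" by (auto simp: S_def T_def)
  next
    fix a b assume ab: "a \<in> S" "b \<in> T"
    then have "i a < i b" "a < length q" "b < length q" by (auto simp: S_def T_def)
    then have "a < b"
      using i(1) by (metis lessThan_iff linorder_neqE_nat order_less_asym strict_mono_on_def)
    have "(s @ t) ! i a \<in> set s" using ab by (auto simp: S_def nth_append)
    moreover have "(s @ t) ! i b \<in> set t" using ab i(2)[of b] by (auto simp: T_def nth_append)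
    ultimately have "(s @ t) ! i b < (s @ t) ! i a" using st by (auto simp: entries_above_def)
    then show "a < b \<and> q ! b < q ! a"
      using \<open>a < b\<close> i(3) \<open>a < length q\<close> \<open>b < length q\<close> by blast
  qed
  then show ?thesis
  proof
    assume "T = {}"
    then have "i r < length s" if "r < length q" for r
      using that by (auto simp: T_def)
    then have "contains_pattern s q"
      unfolding contains_pattern_def using i by (intro exI[of _ i]) (auto simp: nth_append)
    then show ?thesis ..
  next
    assume "S = {}"
    then have ge: "length s \<le> i r" if "r < length q" for r
      using that by (auto simp: S_def)
    have "strict_mono_on {..<length q} (\<lambda>r. i r - length s)"
      using i(1) ge by (auto simp: strict_mono_on_def intro!: diff_less_mono)
    moreover have "i r - length s < length t" if "r < length q" for r
      using i(2)[OF that] ge[OF that] by auto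
    moreover have "t ! (i r - length s) = (s @ t) ! i r" if "r < length q" for r
      using ge[OF that] by (auto simp: nth_append)
    ultimately have "contains_pattern t q"
      unfolding contains_pattern_def using i(3)
      by (intro exI[of _ "\<lambda>r. i r - length s"]) auto
    then show ?thesis ..
  qed
qed

lemma contains_pattern_append_iff:
  assumes "skew_indecomposable q" "entries_above s t"
  shows "contains_pattern (s @ t) q \<longleftrightarrow> contains_pattern s q \<or> contains_pattern t q"
  using contains_pattern_appendD[OF assms] contains_pattern_insert[of s "[]" q t]
    contains_pattern_insert[of "[]" t q s] by auto

text \<open>Only the relative order of the entries matters, so a skew block can be brought down to
  the values \<open>{1..a}\<close> without affecting avoidance.\<close>

lemma contains_pattern_shift:
  "contains_pattern (map ((+) c) p) q \<longleftrightarrow> contains_pattern p q"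
  unfolding contains_pattern_def length_map
  by (intro ex_cong1 conj_cong refl) (metis add_less_cancel_left nth_map)

lemma skew_indecomposable_shift:
  "skew_indecomposable (map ((+) c) p) \<longleftrightarrow> skew_indecomposable p"
proof -
  have "(\<exists>s t. s \<noteq> [] \<and> t \<noteq> [] \<and> map ((+) c) p = s @ t \<and> entries_above s t) \<longleftrightarrow>
        (\<exists>s t. s \<noteq> [] \<and> t \<noteq> [] \<and> p = s @ t \<and> entries_above s t)" (is "?l \<longleftrightarrow> ?r")
  proof
    assume ?l
    then obtain s t where st: "s \<noteq> []" "t \<noteq> []" "map ((+) c) p = s @ t" "entries_above s t"
      by blast
    then obtain s' t' where "p = s' @ t'" "s = map ((+) c) s'" "t = map ((+) c) t'"
      by (auto simp: map_eq_append_conv)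
    with st show ?r by (auto simp: entries_above_def)
  next
    assume ?r
    then obtain s t where "s \<noteq> []" "t \<noteq> []" "p = s @ t" "entries_above s t" by blast
    then show ?l
      by (intro exI[of _ "map ((+) c) s"] exI[of _ "map ((+) c) t"]) (auto simp: entries_above_def)
  qed
  then show ?thesis by (simp add: skew_indecomposable_def)
qed

lemma skew_indecomposable_length_pos: "skew_indecomposable p \<Longrightarrow> 0 < length p"
  by (simp add: skew_indecomposable_def)

section \<open>Removing the first skew block\<close>

lemma length_permutations_interval: "p \<in> permutations_of_set {1..n} \<Longrightarrow> length p = n"
  by (metis card_atLeastAtMost diff_Suc_1 length_finite_permutations_of_set)

text \<open>No element of \<open>A\<close> lies in \<open>{1..Max B}\<close>, so \<open>B\<close>
  fills this interval. This makes the part after the first skew block a permutation again.\<close>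

lemma initial_segment_eqI:
  fixes A B :: "nat set"
  assumes "A \<union> B = {1..n}" and "\<And>a b. a \<in> A \<Longrightarrow> b \<in> B \<Longrightarrow> b < a"
  shows "B = {1..card B}"
proof (cases "B = {}")
  case False
  have fin: "finite B" using assms(1) by (metis finite_Un finite_atLeastAtMost)
  define m where "m = Max B"
  have m: "m \<in> B" using fin False m_def by auto
  have "B = {1..m}"
  proof (intro equalityI subsetI)
    fix x assume "x \<in> B"
    then show "x \<in> {1..m}" using fin m_def assms(1) by (metis Max_ge UnCI atLeastAtMost_iff)
  next
    fix x assume "x \<in> {1..m}"
    moreover have "m \<le> n" using m assms(1) by (metis UnCI atLeastAtMost_iff)
    ultimately have "x \<in> A \<union> B" using assms(1) by simp
    moreover have "x \<notin> A" using assms(2)[of x m] m \<open>x \<in> {1..m}\<close> by auto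
    ultimately show "x \<in> B" by blast
  qed
  then show ?thesis by simp
qed simp

text \<open>Cutting off the first skew block, of length \<open>a\<close>, is a bijection onto pairs
  of an indecomposable avoider and an avoider of length \<open>n - a\<close>. The predicate
  \<open>R\<close> lets this one bijection serve both for a fixed number of blocks and for all
  avoiders.\<close>

lemma card_remove_first_block:
  assumes q: "skew_indecomposable q"
  shows "card {p \<in> permutations_of_set {1..n}. avoids_pattern p q \<and> p \<noteq> [] \<and>
            R (length (tl (skew_blocks p)))} =
    (\<Sum>a=1..n. Av_blocks a 1 q *
       card {t \<in> permutations_of_set {1..n-a}. avoids_pattern t q \<and> R (length (skew_blocks t))})"
    (is "card ?X = (\<Sum>a=1..n. _ * card (?W a))")
proof -
  define V where
    "V a = {s \<in> permutations_of_set {1..a}. avoids_pattern s q \<and> skew_indecomposable s}" for a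
  define D where "D = (SIGMA a:{1..n}. V a \<times> ?W a)"
  \<comment> \<open>The entries of \<open>t\<close> are \<open>{1..n-a}\<close>, so lifting
    \<open>s\<close> by \<open>n - a\<close> places it exactly above \<open>t\<close>.\<close>
  define \<phi> where "\<phi> = (\<lambda>(a, s, t). map ((+) (n - a)) s @ t :: nat list)"
  have above: "entries_above (map ((+) (n - a)) s) t" if "(a, s, t) \<in> D" for a s t
    using that by (fastforce simp: D_def V_def permutations_of_set_def entries_above_def)
  have blocks: "skew_blocks (\<phi> (a, s, t)) = map ((+) (n - a)) s # skew_blocks t"
    if "(a, s, t) \<in> D" for a s t
    using skew_blocks_append[OF _ above[OF that]] that
    by (auto simp: \<phi>_def D_def V_def skew_indecomposable_shift)
  have "bij_betw \<phi> D ?X"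
  proof (rule bij_betw_imageI)
    show "inj_on \<phi> D"
    proof (rule inj_onI)
      fix x y assume xy: "x \<in> D" "y \<in> D" "\<phi> x = \<phi> y"
      obtain a s t a' s' t' where x: "x = (a, s, t)" and y: "y = (a', s', t')"
        by (metis prod_cases3)
      note D = xy(1,2)[unfolded x y] and eq = xy(3)[unfolded x y]
      \<comment> \<open>The list determines its first skew block; the length of that block returns
        \<open>a\<close> and with it the shift.\<close>
      have m: "map ((+) (n - a)) s = map ((+) (n - a')) s'"
        using blocks[OF D(1)] blocks[OF D(2)] eq by simp
      then have "length s = length s'" by (metis length_map)
      moreover have "length s = a" "length s' = a'"
        using D by (auto simp: D_def V_def length_permutations_interval simp del: One_nat_def)
      ultimately have a: "a = a'" by simp
      moreover have "s = s'"
        using m unfolding a by (simp add: inj_map_eq_map)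
      ultimately show "x = y"
        using eq x y by (simp add: \<phi>_def)
    qed
    show "\<phi> ` D = ?X"
    proof (intro equalityI subsetI)
      fix p assume "p \<in> \<phi> ` D"
      then obtain a s t where D: "(a, s, t) \<in> D" and p: "p = \<phi> (a, s, t)" by auto
      have a: "a \<le> n" and s: "set s = {1..a}" "distinct s" "avoids_pattern s q"
        and t: "set t = {1..n-a}" "distinct t" "avoids_pattern t q" "R (length (skew_blocks t))"
        and s': "skew_indecomposable s"
        using D by (auto simp: D_def V_def permutations_of_set_def)
      have im: "(+) (n - a) ` {1..a} = {n - a + 1..n}"
        unfolding image_add_atLeastAtMost using a by simp
      have "set p = (+) (n - a) ` set s \<union> set t" by (simp add: p \<phi>_def)
      also have "\<dots> = {1..n}" unfolding s(1) t(1) im using a by auto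
      finally have "set p = {1..n}" .
      moreover have "distinct p"
        using s t a im by (auto simp: p \<phi>_def distinct_map inj_on_def)
      moreover have "avoids_pattern p q"
        using contains_pattern_append_iff[OF q above[OF D]] s t
        by (simp add: p \<phi>_def contains_pattern_shift)
      moreover have "p \<noteq> []" using skew_indecomposable_length_pos[OF s'] by (auto simp: p \<phi>_def)
      moreover have "R (length (tl (skew_blocks p)))"
        unfolding p blocks[OF D] using t by simp
      ultimately show "p \<in> ?X" by (simp add: permutations_of_set_def)
    next
      fix p assume "p \<in> ?X"
      then have p: "set p = {1..n}" "distinct p" "avoids_pattern p q" "p \<noteq> []"
        "R (length (tl (skew_blocks p)))"
        by (auto simp: permutations_of_set_def)
      then obtain u us where us: "skew_blocks p = u # us"
        using skew_blocks_eq_Nil_iff by (cases "skew_blocks p") auto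
      define t where "t = concat us"
      note u = skew_blocks_ConsE[OF us, folded t_def]
      define a where "a = length u"
      have len: "length u + length t = n"
        using p(1,2) u(1) by (metis card_atLeastAtMost diff_Suc_1 distinct_card length_append)
      have "set t = {1..card (set t)}"
        using p(1) u(1,3) by (intro initial_segment_eqI[of "set u" _ n]) (auto simp: entries_above_def)
      moreover have "card (set t) = n - a"
        using p(2) u(1) len by (simp add: a_def distinct_card)
      ultimately have t: "set t = {1..n-a}" by simp
      have gt: "n - a < x" if "x \<in> set u" for x
      proof (rule ccontr)
        assume "\<not> n - a < x"
        moreover have "x \<ge> 1" using that p(1) u(1) by auto
        ultimately have "x \<in> set t" using t by auto
        then show False using p(2) u(1) that by auto
      qed
      \<comment> \<open>By \<open>gt\<close> this subtraction is never truncated, so the shift can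
        be undone.\<close>
      define s where "s = map (\<lambda>x. x - (n - a)) u"
      have su: "map ((+) (n - a)) s = u"
        unfolding s_def map_map by (rule map_idI) (use gt in fastforce)
      have "distinct s"
        using p(2) u(1) su by (metis distinct_append distinct_map)
      moreover have "set s = {1..a}"
      proof (rule card_subset_eq)
        show "set s \<subseteq> {1..a}"
        proof
          fix y assume "y \<in> set s"
          then obtain x where x: "x \<in> set u" "y = x - (n - a)" by (auto simp: s_def)
          moreover have "x \<le> n" using x p(1) u(1) by auto
          ultimately show "y \<in> {1..a}" using gt[OF x(1)] by auto
        qed
        show "card (set s) = card {1..a}"
          using distinct_card[OF \<open>distinct s\<close>] by (simp add: s_def a_def)
      qed simp
      moreover have "avoids_pattern s q" "avoids_pattern t q"
        using p(3) contains_pattern_append_iff[OF q u(3)] u(1) su contains_pattern_shift by metis+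
      moreover have "skew_indecomposable s"
        using u(2) su skew_indecomposable_shift by metis
      moreover have "distinct t" using p(2) u(1) by simp
      moreover have "1 \<le> a" "a \<le> n"
        using skew_indecomposable_length_pos[OF u(2)] len unfolding a_def by linarith+
      moreover have "R (length (skew_blocks t))" using p(5) us u(4) by simp
      ultimately have "(a, s, t) \<in> D"
        using t by (auto simp: D_def V_def permutations_of_set_def)
      moreover have "p = \<phi> (a, s, t)" by (simp add: \<phi>_def su u(1)[symmetric])
      ultimately show "p \<in> \<phi> ` D" by blast
    qed
  qed
  then have "card ?X = card D" by (rule bij_betw_same_card[symmetric])
  also have "\<dots> = (\<Sum>a=1..n. card (V a \<times> ?W a))"
    unfolding D_def by (rule card_SigmaI) (auto simp: V_def)
  also have "\<dots> = (\<Sum>a=1..n. Av_blocks a 1 q * card (?W a))"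
    unfolding V_def Av_blocks_def length_skew_blocks_eq_1_iff card_cartesian_product ..
  finally show ?thesis .
qed

section \<open>Coefficient recurrences and Wilf invariance\<close>

lemma Av_blocks_Suc:
  assumes "skew_indecomposable q"
  shows "Av_blocks n (Suc l) q = (\<Sum>a=1..n. Av_blocks a 1 q * Av_blocks (n - a) l q)"
proof -
  \<comment> \<open>Since \<open>tl [] = []\<close>, the condition \<open>p \<noteq> []\<close> is
    what keeps the empty permutation out when \<open>l = 0\<close>.\<close>
  have "p \<noteq> [] \<and> length (tl (skew_blocks p)) = l \<longleftrightarrow> length (skew_blocks p) = Suc l" for p
    using skew_blocks_eq_Nil_iff[of p] by (cases "skew_blocks p") auto
  then show ?thesis
    using card_remove_first_block[OF assms, of n "\<lambda>m. m = l"] by (simp add: Av_blocks_def)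
qed

text \<open>This is \<open>A = 1 + B * A\<close> in coefficients, with \<open>A\<close> the
  generating function of all avoiders. The constant term is excluded because the empty permutation
  has no first block.\<close>

lemma Av_rec:
  assumes "skew_indecomposable q" and "1 \<le> n"
  shows "Av n q = (\<Sum>a=1..n. Av_blocks a 1 q * Av (n - a) q)"
proof -
  have "{p \<in> permutations_of_set {1..n}. avoids_pattern p q} =
        {p \<in> permutations_of_set {1..n}. avoids_pattern p q \<and> p \<noteq> [] \<and> True}"
    using assms(2) by (auto simp: permutations_of_set_def)
  then show ?thesis
    unfolding Av_def using card_remove_first_block[OF assms(1), of n "\<lambda>_. True"] by simp
qed

text \<open>Wilf equivalence says nothing about length 0, so that value is supplied here. It also
  turns the term \<open>a = n\<close> of \<open>Av_rec\<close> into
  \<open>Av_blocks n 1 q\<close>.\<close>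

lemma Av_0:
  assumes "skew_indecomposable q"
  shows "Av 0 q = 1"
proof -
  have "avoids_pattern [] q"
    using skew_indecomposable_length_pos[OF assms] by (auto simp: contains_pattern_def)
  then have "{p \<in> permutations_of_set {1..0::nat}. avoids_pattern p q} = {[]}"
    by auto
  then show ?thesis by (simp add: Av_def)
qed

text \<open>\<open>Av_rec\<close> can be solved for its top term \<open>Av_blocks n 1 q\<close>, all
  other terms involving either smaller indecomposable avoiders or values of \<open>Av\<close>. Thus
  \<open>A\<close> determines \<open>B\<close> by strong induction.\<close>

lemma wilf_Av_blocks_1:
  assumes "skew_indecomposable q" "skew_indecomposable q'" "wilf_equivalent q q'"
  shows "Av_blocks n 1 q = Av_blocks n 1 q'"
proof (induction n rule: less_induct)
  case (less n)
  have Av: "Av m q = Av m q'" for m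
    using assms Av_0 by (cases "m = 0") (auto simp: wilf_equivalent_def)
  show ?case
  proof (cases n)
    case 0
    then show ?thesis by (auto simp: Av_blocks_def intro!: arg_cong[where f = card])
  next
    case (Suc m)
    have split: "Av n r = (\<Sum>a=1..m. Av_blocks a 1 r * Av (n - a) r) + Av_blocks n 1 r"
      if "skew_indecomposable r" for r
      using Av_rec[OF that, of n] Av_0[OF that] Suc by simp
    have "(\<Sum>a=1..m. Av_blocks a 1 q * Av (n - a) q) = (\<Sum>a=1..m. Av_blocks a 1 q' * Av (n - a) q')"
      using less Suc Av by (intro sum.cong) auto
    then show ?thesis using split[OF assms(1)] split[OF assms(2)] Av[of n] by simp
  qed
qed

lemma wilf_Av_blocks_2:
  assumes "skew_indecomposable q" "skew_indecomposable q'" "wilf_equivalent q q'"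
  shows "Av_blocks n 2 q = Av_blocks n 2 q'"
proof -
  have "Av_blocks n 2 r = (\<Sum>a=1..n. Av_blocks a 1 r * Av_blocks (n - a) 1 r)"
    if "skew_indecomposable r" for r
    using Av_blocks_Suc[OF that, of n 1] by (simp only: Suc_1)
  from this[OF assms(1)] this[OF assms(2)] show ?thesis
    unfolding wilf_Av_blocks_1[OF assms] by (simp only:)
qed

text \<open>The inequality between \<open>B ^ 2\<close> and \<open>B\<close> is multiplied by
  \<open>B\<close> repeatedly, which preserves it since all coefficients are nonnegative. Each
  removal of a first block leaves length \<open>n - a\<close>, hence the induction over all
  \<open>n\<close> at once.\<close>

lemma Av_blocks_antimono:
  assumes q: "skew_indecomposable q" and base: "\<And>n. Av_blocks n 2 q \<le> Av_blocks n 1 q"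
    and "1 \<le> l"
  shows "Av_blocks n (l + 1) q \<le> Av_blocks n l q"
  using \<open>1 \<le> l\<close>
proof (induction l arbitrary: n rule: dec_induct)
  case base
  then show ?case using assms(2) by (simp add: numeral_2_eq_2)
next
  case (step l)
  then show ?case
    using Av_blocks_Suc[OF q, of n "Suc l"] Av_blocks_Suc[OF q, of n l]
    by (auto intro!: sum_mono)
qed

section \<open>Merging two skew blocks\<close>

text \<open>The diagram of the permutation. Positions are counted from 1 here, so that both
  coordinates range over \<open>{1..n}\<close> and the symmetries of the square act on it.\<close>

definition points :: "nat list \<Rightarrow> (nat \<times> nat) set" where
  "points p = (\<lambda>r. (Suc r, p ! r)) ` {..<length p}"

definition northwest :: "(nat \<times> nat) set \<Rightarrow> (nat \<times> nat) set \<Rightarrow> bool" where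
  "northwest S T \<longleftrightarrow> (\<forall>x\<in>S. \<forall>y\<in>T. fst x < fst y \<and> snd y < snd x)"

text \<open>The obstructing shape \<open>f # L @ R\<close> of a pattern, with \<open>S\<close> and
  \<open>T\<close> the points of \<open>L\<close> and \<open>R\<close>; the values of
  \<open>T\<close> may lie on both sides of that of \<open>f\<close>. It is phrased for point sets
  so that it can be tested on the image of a pattern under a symmetry.\<close>

definition splits_after_first :: "(nat \<times> nat) set \<Rightarrow> bool" where
  "splits_after_first Q \<longleftrightarrow>
     (\<exists>f S T. Q = insert f (S \<union> T) \<and> S \<noteq> {} \<and> T \<noteq> {} \<and> northwest S T \<and>
        (\<forall>x\<in>S \<union> T. fst f < fst x) \<and> (\<forall>x\<in>S. snd f < snd x))"

text \<open>An occurrence that misses \<open>f\<close>, or uses \<open>f\<close> and otherwise only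
  \<open>R\<close>, is already present before the move. One using \<open>f\<close> and otherwise
  only \<open>L\<close> makes the first entry of \<open>q\<close> its least one. One using
  \<open>f\<close>, \<open>L\<close> and \<open>R\<close> gives \<open>q\<close> the obstructing
  shape.\<close>

lemma contains_pattern_move_front:
  assumes q: "q \<in> permutations_of_set {1..k}" "q \<noteq> []" "hd q \<noteq> 1"
    and fL: "\<And>x. x \<in> set L \<Longrightarrow> f < x" and LR: "entries_above L R"
    and "contains_pattern (f # L @ R) q"
  shows "contains_pattern (L @ f # R) q \<or> splits_after_first (points q)"
proof -
  let ?p = "f # L @ R"
  from assms(6) obtain i where i: "strict_mono_on {..<length q} i"
      "\<And>r. r < length q \<Longrightarrow> i r < length ?p"
      "\<And>r s. r < length q \<Longrightarrow> s < length q \<Longrightarrow> ?p ! i r < ?p ! i s \<longleftrightarrow> q ! r < q ! s"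
    unfolding contains_pattern_def by blast
  have less: "i r < i s" if "r < s" "s < length q" for r s
    using i(1) that by (auto simp: strict_mono_on_def)
  have less_iff: "r < s" if "i r < i s" "r < length q" for r s
    using that less by (metis linorder_neqE_nat order_less_asym)
  have pos: "0 < length q" using q(2) by simp
  show ?thesis
  proof (cases "i 0 = 0")
    case False
    have ge: "0 < i r" if "r < length q" for r
      using less[of 0 r] that False by (cases "r = 0") auto
    have "strict_mono_on {..<length q} (\<lambda>r. i r - 1)"
      using less ge by (auto simp: strict_mono_on_def intro!: diff_less_mono Suc_leI)
    moreover have "i r - 1 < length (L @ R)" if "r < length q" for r
      using i(2)[OF that] ge[OF that] by auto
    moreover have "(L @ R) ! (i r - 1) = ?p ! i r" if "r < length q" for r
      using ge[OF that] by simp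
    ultimately have "contains_pattern (L @ R) q"
      unfolding contains_pattern_def using i(3)
      by (intro exI[of _ "\<lambda>r. i r - 1"]) auto
    then show ?thesis using contains_pattern_insert[of L R q "[f]"] by simp
  next
    case True
    define S where "S = {r. 0 < r \<and> r < length q \<and> i r \<le> length L}"
    define T where "T = {r. r < length q \<and> length L < i r}"
    have i_pos: "0 < i r" if "0 < r" "r < length q" for r
      using less[OF that] by simp
    have in_L: "?p ! i r \<in> set L" if "r \<in> S" for r
      using that i_pos[of r] by (auto simp: S_def nth_Cons' nth_append)
    have in_R: "?p ! i r \<in> set R" if "r \<in> T" for r
      using that i(2)[of r] by (auto simp: T_def nth_Cons' nth_append)
    have S_gt: "q ! 0 < q ! r" if "r \<in> S" for r
      using i(3)[of 0 r] fL[OF in_L[OF that]] that True pos by (auto simp: S_def)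
    show ?thesis
    proof (cases "S = {} \<or> T = {}")
      case empty: True
      show ?thesis
      proof (cases "S = {}")
        case True
        then have gt: "length L < i r" if "0 < r" "r < length q" for r
          using that by (auto simp: S_def not_le)
        \<comment> \<open>Here truncation is wanted: it leaves \<open>f\<close> at position 0, while
          position \<open>length L + j\<close> goes to position \<open>j\<close> of
          \<open>f # R\<close>.\<close>
        have "strict_mono_on {..<length q} (\<lambda>r. i r - length L)"
        proof (rule strict_mono_onI)
          fix r s assume "r \<in> {..<length q}" "s \<in> {..<length q}" "r < s"
          then have "i r < i s" "length L < i s" using less gt by auto
          then show "i r - length L < i s - length L" by auto
        qed
        moreover have "i r - length L < length (f # R)" if "r < length q" for r
          using i(2)[OF that] by auto
        moreover have "(f # R) ! (i r - length L) = ?p ! i r" if "r < length q" for r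
          using gt[of r] that \<open>i 0 = 0\<close> by (cases "r = 0") (auto simp: nth_Cons' nth_append)
        ultimately have "contains_pattern (f # R) q"
          unfolding contains_pattern_def using i(3)
          by (intro exI[of _ "\<lambda>r. i r - length L"]) auto
        then show ?thesis using contains_pattern_insert[of "[]" "f # R" q L] by simp
      next
        case False
        with empty have "T = {}" by simp
        \<comment> \<open>The occurrence lies in \<open>f # L\<close>, where \<open>f\<close> is
          first and least, so \<open>q\<close> would start with 1.\<close>
        then have min: "q ! 0 < q ! r" if "0 < r" "r < length q" for r
          using that S_gt[of r] by (force simp: S_def T_def)
        have set: "set q = {1..k}" using q(1) by (simp add: permutations_of_set_def)
        then have "1 \<le> q ! 0" "1 \<in> set q" using nth_mem[OF pos] by auto
        then obtain r where "r < length q" "q ! r = 1" by (auto simp: in_set_conv_nth)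
        then have "q ! 0 = 1" using min[of r] \<open>1 \<le> q ! 0\<close> by (cases "r = 0") auto
        then show ?thesis using q(2,3) by (simp add: hd_conv_nth)
      qed
    next
      case False
      let ?pt = "\<lambda>r. (Suc r, q ! r)"
      have "{..<length q} = insert 0 (S \<union> T)"
        using pos by (auto simp: S_def T_def)
      then have "points q = insert (?pt 0) (?pt ` S \<union> ?pt ` T)"
        by (simp add: points_def image_Un)
      moreover have "northwest (?pt ` S) (?pt ` T)"
      proof -
        have "r < s \<and> q ! s < q ! r" if rs: "r \<in> S" "s \<in> T" for r s
        proof -
          have "i r < i s" "r < length q" using rs by (auto simp: S_def T_def)
          then have "r < s" by (rule less_iff)
          moreover have "?p ! i s < ?p ! i r"
            using LR in_L[OF rs(1)] in_R[OF rs(2)] by (simp add: entries_above_def)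
          then have "q ! s < q ! r" using i(3)[of s r] rs by (simp add: S_def T_def)
          ultimately show ?thesis by simp
        qed
        then show ?thesis by (simp add: northwest_def)
      qed
      moreover have "0 < r" if "r \<in> S \<union> T" for r
        using that True by (cases "r = 0") (auto simp: S_def T_def)
      then have "\<forall>x\<in>?pt ` S \<union> ?pt ` T. fst (?pt 0) < fst x" by auto
      moreover have "?pt ` S \<noteq> {}" "?pt ` T \<noteq> {}" using False by auto
      moreover have "\<forall>x\<in>?pt ` S. snd (?pt 0) < snd x" using S_gt by simp
      ultimately have "splits_after_first (points q)"
        unfolding splits_after_first_def
        by (intro exI[of _ "?pt 0"] exI[of _ "?pt ` S"] exI[of _ "?pt ` T"] conjI) auto
      then show ?thesis ..
    qed
  qed
qed

text \<open>The first part of a cut contains \<open>f\<close>, so the second part contains nothing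
  above \<open>f\<close> and hence no entry of \<open>L\<close>. The cut therefore falls at or
  beyond the end of \<open>L\<close>, and deleting \<open>L\<close> leaves a cut of
  \<open>f # R\<close>.\<close>

lemma skew_indecomposable_move_front:
  assumes "skew_indecomposable (f # R)" "L \<noteq> []" and fL: "\<And>x. x \<in> set L \<Longrightarrow> f < x"
  shows "skew_indecomposable (f # L @ R)"
proof -
  have False if st: "s \<noteq> []" "t \<noteq> []" "f # L @ R = s @ t" "entries_above s t" for s t
  proof -
    obtain s' where s: "s = f # s'" "L @ R = s' @ t"
      using st(1,3) by (cases s) auto
    have above: "entries_above (f # u) t" if "set u \<subseteq> set s" for u
      using that st(4) s by (auto simp: entries_above_def)
    have R: "\<And>u. f # R = (f # u) @ t \<Longrightarrow> \<not> entries_above (f # u) t"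
      using assms(1) st(2) unfolding skew_indecomposable_def by blast
    from s(2) obtain u where "L = s' @ u \<and> u @ R = t \<or> L @ u = s' \<and> R = u @ t"
      by (auto simp: append_eq_append_conv2)
    then show False
    proof
      assume u: "L = s' @ u \<and> u @ R = t"
      show False
      proof (cases u)
        case Nil
        then show False using u R[of "[]"] above[of "[]"] by simp
      next
        case (Cons x v)
        then have "x < f" "f < x"
          using u fL[of x] \<open>entries_above s t\<close> s(1) by (auto simp: entries_above_def)
        then show False by simp
      qed
    next
      assume u: "L @ u = s' \<and> R = u @ t"
      then have "set u \<subseteq> set s" using s(1) by auto
      then have "entries_above (f # u) t" by (rule above)
      then show False using R[of u] u by simp
    qed
  qed
  then show ?thesis unfolding skew_indecomposable_def by blast
qed

lemma Av_blocks_2_le_1: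
  assumes q: "q \<in> permutations_of_set {1..k}" "q \<noteq> []" "hd q \<noteq> 1"
    and nsplit: "\<not> splits_after_first (points q)"
  shows "Av_blocks n 2 q \<le> Av_blocks n 1 q"
proof -
  let ?X = "\<lambda>l. {p \<in> permutations_of_set {1..n}. avoids_pattern p q \<and> length (skew_blocks p) = l}"
  \<comment> \<open>Only lists with exactly two blocks matter; elsewhere the value may be
    arbitrary.\<close>
  define \<phi> where "\<phi> p = (case skew_blocks p of L # M # _ \<Rightarrow> hd M # L @ tl M)" for p
  have X2: "\<exists>L f R. p = L @ f # R \<and> skew_indecomposable L \<and> skew_indecomposable (f # R) \<and>
      entries_above L (f # R) \<and> \<phi> p = f # L @ R" if p: "p \<in> ?X 2" for p
  proof -
    obtain L M where LM: "skew_blocks p = [L, M]"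
      using p by (auto simp: length_Suc_conv numeral_2_eq_2)
    have "is_skew_decomposition p [L, M]"
      using skew_blocks_decomposition[of p] LM by simp
    then have *: "p = L @ M" "skew_indecomposable L" "skew_indecomposable M" "entries_above L M"
      by (auto simp: is_skew_decomposition_def)
    then obtain f R where "M = f # R" by (cases M) (auto simp: skew_indecomposable_def)
    with * LM show ?thesis by (intro exI[of _ L] exI[of _ f] exI[of _ R]) (simp add: \<phi>_def)
  qed
  have "inj_on \<phi> (?X 2)"
  proof (rule inj_onI)
    fix p p' assume X: "p \<in> ?X 2" "p' \<in> ?X 2" and eq: "\<phi> p = \<phi> p'"
    from X2[OF X(1)] obtain L f R where
      p: "p = L @ f # R" "skew_indecomposable L" "entries_above L (f # R)" "\<phi> p = f # L @ R"
      by blast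
    from X2[OF X(2)] obtain L' f' R' where
      p': "p' = L' @ f' # R'" "skew_indecomposable L'" "entries_above L' (f' # R')"
        "\<phi> p' = f' # L' @ R'"
      by blast
    have f: "f = f'" and LR: "L @ R = L' @ R'" using eq p(4) p'(4) by auto
    \<comment> \<open>Without \<open>f\<close> the second block may fall apart or vanish, but
      \<open>L\<close> is still above what remains and so still the first block.\<close>
    have "skew_blocks (L @ R) = L # skew_blocks R" "skew_blocks (L' @ R') = L' # skew_blocks R'"
      using p(2,3) p'(2,3) by (auto intro!: skew_blocks_append simp: entries_above_def)
    then have "L = L'" using LR by simp
    then show "p = p'" using f LR p(1) p'(1) by simp
  qed
  moreover have "\<phi> ` ?X 2 \<subseteq> ?X 1"
  proof (rule image_subsetI)
    fix p assume X: "p \<in> ?X 2"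
    then obtain L f R where
      p: "p = L @ f # R" "skew_indecomposable L" "skew_indecomposable (f # R)"
        "entries_above L (f # R)" "\<phi> p = f # L @ R"
      using X2[OF X] by blast
    have fL: "f < x" if "x \<in> set L" for x using that p(4) by (auto simp: entries_above_def)
    have "L \<noteq> []" using p(2) by (auto simp: skew_indecomposable_def)
    then have "skew_indecomposable (\<phi> p)"
      using skew_indecomposable_move_front[OF p(3) _ fL] p(5) by simp
    moreover have "avoids_pattern (\<phi> p) q"
      using contains_pattern_move_front[OF q fL, of L R] p nsplit X
      by (auto simp: entries_above_def)
    moreover have "\<phi> p \<in> permutations_of_set {1..n}"
      using X p(1,5) by (auto simp: permutations_of_set_def)
    ultimately show "\<phi> p \<in> ?X 1" using length_skew_blocks_eq_1_iff by blast
  qed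
  moreover have "finite (?X 1)" by simp
  ultimately show ?thesis unfolding Av_blocks_def by (rule card_inj_on_le)
qed

section \<open>Symmetries\<close>

definition perm_points :: "nat \<Rightarrow> (nat \<times> nat) set set" where
  "perm_points n = {P. P \<subseteq> {1..n} \<times> {1..n} \<and> inj_on fst P \<and> inj_on snd P \<and> card P = n}"

text \<open>Positions and values play equal roles here, unlike in \<open>contains_pattern\<close>,
  so exchanging the coordinates is harmless.\<close>

definition embeds :: "(nat \<times> nat) set \<Rightarrow> (nat \<times> nat) set \<Rightarrow> bool" where
  "embeds Q P \<longleftrightarrow> (\<exists>g. g ` Q \<subseteq> P \<and>
     (\<forall>x\<in>Q. \<forall>y\<in>Q. (fst (g x) < fst (g y) \<longleftrightarrow> fst x < fst y) \<and> (snd (g x) < snd (g y) \<longleftrightarrow> snd x < snd y)))"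

definition skew_connected :: "(nat \<times> nat) set \<Rightarrow> bool" where
  "skew_connected Q \<longleftrightarrow> Q \<noteq> {} \<and> (\<forall>S T. Q = S \<union> T \<longrightarrow> northwest S T \<longrightarrow> S = {} \<or> T = {})"

text \<open>The half-turn of the square \<open>{1..n} \<times> {1..n}\<close>; inside the square
  neither subtraction is truncated.\<close>

definition reverse_complement :: "nat \<Rightarrow> nat \<times> nat \<Rightarrow> nat \<times> nat" where
  "reverse_complement n x = (Suc n - fst x, Suc n - snd x)"

lemma inj_on_points: "inj_on points (permutations_of_set {1..n})"
proof (rule inj_onI)
  fix p p' assume p: "p \<in> permutations_of_set {1..n}" "p' \<in> permutations_of_set {1..n}"
    and eq: "points p = points p'"
  show "p = p'"
  proof (rule nth_equalityI)
    show "length p = length p'" using p by (simp add: length_permutations_interval del: One_nat_def)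
    fix r assume "r < length p"
    then have "(Suc r, p ! r) \<in> points p'" unfolding eq[symmetric] by (auto simp: points_def)
    then show "p ! r = p' ! r" by (auto simp: points_def)
  qed
qed

text \<open>For surjectivity, \<open>n\<close> points with injective projections into
  \<open>{1..n}\<close> project onto it. Each column then holds exactly one point, and reading off
  its height gives the list.\<close>

lemma points_image: "points ` permutations_of_set {1..n} = perm_points n"
proof (intro equalityI subsetI)
  fix P assume "P \<in> points ` permutations_of_set {1..n}"
  then obtain p where P: "P = points p" and "p \<in> permutations_of_set {1..n}" by blast
  then have p: "length p = n" "set p = {1..n}" "distinct p"
    by (simp_all add: length_permutations_interval permutations_of_set_def del: One_nat_def)
  have "inj_on (\<lambda>r. (Suc r, p ! r)) {..<n}" by (auto simp: inj_on_def)
  then have "card P = n" by (simp add: P points_def p card_image)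
  moreover have "p ! r \<in> {1..n}" if "r < n" for r using that p nth_mem by metis
  then have "P \<subseteq> {1..n} \<times> {1..n}" by (auto simp: P points_def p)
  moreover have "inj_on fst P" by (auto simp: P points_def inj_on_def)
  moreover have "inj_on snd P" using p by (auto simp: P points_def inj_on_def nth_eq_iff_index_eq)
  ultimately show "P \<in> perm_points n" by (simp add: perm_points_def)
next
  fix P assume "P \<in> perm_points n"
  then have P: "P \<subseteq> {1..n} \<times> {1..n}" "inj_on fst P" "inj_on snd P" "card P = n"
    by (auto simp: perm_points_def)
  have fst: "fst ` P = {1..n}"
    using P(1) by (intro card_subset_eq) (auto simp: card_image[OF P(2)] P(4))
  have snd: "snd ` P = {1..n}"
    using P(1) by (intro card_subset_eq) (auto simp: card_image[OF P(3)] P(4))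
  define g where "g = the_inv_into P fst"
  have g: "g i \<in> P" "fst (g i) = i" if "i \<in> {1..n}" for i
    using that P(2) fst unfolding g_def by (metis the_inv_into_into order_refl f_the_inv_into_f)+
  have g': "g (fst x) = x" if "x \<in> P" for x
    using that P(2) by (simp add: g_def the_inv_into_f_f)
  define p where "p = map (\<lambda>r. snd (g (Suc r))) [0..<n]"
  have len: "length p = n" by (simp add: p_def)
  have pts: "points p = g ` {1..n}"
  proof -
    have "points p = (\<lambda>r. g (Suc r)) ` {..<n}"
      unfolding points_def len using g(2)
      by (intro image_cong refl) (auto simp: p_def prod_eq_iff)
    also have "\<dots> = g ` Suc ` {..<n}" by (simp add: image_image)
    also have "Suc ` {..<n} = {1..n}" by (simp add: image_Suc_lessThan)
    finally show ?thesis .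
  qed
  also have "\<dots> = P" unfolding fst[symmetric] using g' by force
  finally have pP: "points p = P" .
  have "set p = snd ` points p" by (auto simp: points_def image_image set_conv_nth)
  then have "set p = {1..n}" using pP snd by simp
  moreover have "distinct p" using \<open>set p = {1..n}\<close> len by (intro card_distinct) simp
  ultimately have "p \<in> permutations_of_set {1..n}" by (simp add: permutations_of_set_def)
  then show "P \<in> points ` permutations_of_set {1..n}" using pP by blast
qed

lemma contains_pattern_iff_embeds: "contains_pattern p q \<longleftrightarrow> embeds (points q) (points p)"
proof
  assume "contains_pattern p q"
  then obtain i where i: "strict_mono_on {..<length q} i"
      "\<And>r. r < length q \<Longrightarrow> i r < length p"
      "\<And>r s. r < length q \<Longrightarrow> s < length q \<Longrightarrow> p ! i r < p ! i s \<longleftrightarrow> q ! r < q ! s"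
    unfolding contains_pattern_def by blast
  have "i r < i s \<longleftrightarrow> r < s" if "r < length q" "s < length q" for r s
    using i(1) that by (simp add: strict_mono_on_less)
  then show "embeds (points q) (points p)"
    unfolding embeds_def using i(2,3)
    \<comment> \<open>The point map follows the position map; \<open>fst x - 1\<close> undoes the
      \<open>Suc\<close> in \<open>points\<close>.\<close>
    by (intro exI[of _ "\<lambda>x. (Suc (i (fst x - 1)), p ! i (fst x - 1))"]) (auto simp: points_def)
next
  assume "embeds (points q) (points p)"
  then obtain g where g: "g ` points q \<subseteq> points p"
    "\<And>x y. x \<in> points q \<Longrightarrow> y \<in> points q \<Longrightarrow> fst (g x) < fst (g y) \<longleftrightarrow> fst x < fst y"
    "\<And>x y. x \<in> points q \<Longrightarrow> y \<in> points q \<Longrightarrow> snd (g x) < snd (g y) \<longleftrightarrow> snd x < snd y"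
    unfolding embeds_def by metis
  define h where "h r = g (Suc r, q ! r)" for r
  define i where "i r = fst (h r) - 1" for r
  have q: "(Suc r, q ! r) \<in> points q" if "r < length q" for r
    using that by (auto simp: points_def)
  have i: "i r < length p \<and> h r = (Suc (i r), p ! i r)" if "r < length q" for r
  proof -
    have "h r \<in> points p" using g(1) q[OF that] by (auto simp: h_def)
    then show ?thesis by (auto simp: points_def i_def)
  qed
  have "i r < i s \<longleftrightarrow> r < s" "p ! i r < p ! i s \<longleftrightarrow> q ! r < q ! s"
    if "r < length q" "s < length q" for r s
    using g(2,3)[OF q q, OF that] i that by (auto simp flip: h_def)
  then show "contains_pattern p q"
    unfolding contains_pattern_def using i
    by (intro exI[of _ i]) (auto simp: strict_mono_on_def)
qed

text \<open>A northwest partition of the points yields two sets of positions to which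
  \<open>skew_indecomposable_index\<close> applies; conversely, a cut of the list partitions the
  points by position.\<close>

lemma skew_indecomposable_iff_connected: "skew_indecomposable p \<longleftrightarrow> skew_connected (points p)"
proof
  assume p: "skew_indecomposable p"
  have "S = {} \<or> T = {}" if ST: "points p = S \<union> T" "northwest S T" for S T
  proof -
    let ?I = "\<lambda>S. {r. r < length p \<and> (Suc r, p ! r) \<in> S}"
    have "?I S = {} \<or> ?I T = {}"
    proof (rule skew_indecomposable_index[OF p])
      have "(Suc r, p ! r) \<in> S \<union> T" if "r < length p" for r
        using that unfolding ST(1)[symmetric] by (auto simp: points_def)
      then show "?I S \<union> ?I T = {..<length p}" by auto
    next
      fix r s assume "r \<in> ?I S" "s \<in> ?I T"
      then show "r < s \<and> p ! s < p ! r" using ST(2) unfolding northwest_def by fastforce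
    qed
    moreover have "\<exists>r<length p. x = (Suc r, p ! r)" if "x \<in> S \<union> T" for x
      using that unfolding ST(1)[symmetric] by (auto simp: points_def)
    ultimately show ?thesis by blast
  qed
  moreover have "points p \<noteq> {}"
    using skew_indecomposable_length_pos[OF p] by (auto simp: points_def)
  ultimately show "skew_connected (points p)" by (simp add: skew_connected_def)
next
  assume p: "skew_connected (points p)"
  have False if st: "s \<noteq> []" "t \<noteq> []" "p = s @ t" "entries_above s t" for s t
  proof -
    let ?pt = "\<lambda>r. (Suc r, p ! r)"
    let ?S = "?pt ` {..<length s}" and ?T = "?pt ` {length s..<length p}"
    have "points p = ?S \<union> ?T"
      unfolding points_def image_Un[symmetric] using st(3) by (intro arg_cong[where f = "image _"]) auto
    moreover have "northwest ?S ?T"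
      using st(3,4) by (auto simp: northwest_def entries_above_def nth_append)
    moreover have "?S \<noteq> {}" "?T \<noteq> {}" using st(1-3) by auto
    ultimately show False using p unfolding skew_connected_def by blast
  qed
  moreover have "p \<noteq> []" using p by (auto simp: skew_connected_def points_def)
  ultimately show "skew_indecomposable p" unfolding skew_indecomposable_def by blast
qed

section \<open>Symmetric patterns are Wilf-equivalent\<close>

lemma Av_eq_card_points: "Av n q = card {P \<in> perm_points n. \<not> embeds (points q) P}"
proof -
  have "{P \<in> perm_points n. \<not> embeds (points q) P} =
      points ` {p \<in> permutations_of_set {1..n}. avoids_pattern p q}"
    unfolding points_image[symmetric] contains_pattern_iff_embeds by blast
  moreover have "inj_on points {p \<in> permutations_of_set {1..n}. avoids_pattern p q}"
    by (rule inj_on_subset[OF inj_on_points]) auto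
  ultimately show ?thesis by (simp add: Av_def card_image)
qed

text \<open>The common argument for the inverse and the half-turn. Both are involutions that
  preserve embeddings and exchange northwest with southeast, hence the reversed order in
  \<open>nw\<close>.\<close>

lemma symmetric_pattern:
  fixes \<phi> :: "nat \<Rightarrow> nat \<times> nat \<Rightarrow> nat \<times> nat"
  assumes perm: "\<And>n P. P \<in> perm_points n \<Longrightarrow> \<phi> n ` P \<in> perm_points n"
    and inv: "\<And>n P. P \<in> perm_points n \<Longrightarrow> \<phi> n ` \<phi> n ` P = P"
    and emb: "\<And>m n P Q. P \<in> perm_points n \<Longrightarrow> Q \<in> perm_points m \<Longrightarrow> embeds Q P \<Longrightarrow>
                embeds (\<phi> m ` Q) (\<phi> n ` P)"
    and nw: "\<And>n P x y. P \<in> perm_points n \<Longrightarrow> x \<in> P \<Longrightarrow> y \<in> P \<Longrightarrow>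
                northwest {\<phi> n x} {\<phi> n y} \<Longrightarrow> northwest {y} {x}"
    and q: "q \<in> permutations_of_set {1..k}" "skew_indecomposable q"
  obtains q' where "q' \<in> permutations_of_set {1..k}" "skew_indecomposable q'"
    "wilf_equivalent q q'" "points q' = \<phi> k ` points q"
proof -
  have Q: "points q \<in> perm_points k" using q(1) points_image by blast
  then obtain q' where q': "q' \<in> permutations_of_set {1..k}" and pq': "points q' = \<phi> k ` points q"
    using perm points_image by (metis imageE)
  \<comment> \<open>The converse direction applies \<open>emb\<close> to the images and cancels the
    involution, so one implication suffices as hypothesis.\<close>
  have iff: "embeds (\<phi> k ` points q) (\<phi> n ` P) \<longleftrightarrow> embeds (points q) P" if "P \<in> perm_points n" for n P
    using emb[OF that Q] emb[OF perm[OF that] perm[OF Q]] inv[OF that] inv[OF Q] by auto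
  have "Av n q = Av n q'" for n
  proof -
    have "bij_betw ((`) (\<phi> n)) {P \<in> perm_points n. \<not> embeds (points q) P}
        {P \<in> perm_points n. \<not> embeds (points q') P}"
    proof (rule bij_betw_byWitness[where f' = "(`) (\<phi> n)"])
      show "(`) (\<phi> n) ` {P \<in> perm_points n. \<not> embeds (points q') P} \<subseteq>
          {P \<in> perm_points n. \<not> embeds (points q) P}"
      proof clarify
        fix P assume P: "P \<in> perm_points n" "\<not> embeds (points q') P"
        then have "\<not> embeds (points q) (\<phi> n ` P)"
          using iff[OF perm[OF P(1)]] inv[OF P(1)] pq' by simp
        then show "\<phi> n ` P \<in> perm_points n \<and> \<not> embeds (points q) (\<phi> n ` P)"
          using perm[OF P(1)] by blast
      qed
    qed (use inv perm iff pq' in auto)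
    then show ?thesis unfolding Av_eq_card_points by (rule bij_betw_same_card)
  qed
  moreover have "length q = length q'"
    using q(1) q' by (simp add: length_permutations_interval del: One_nat_def)
  ultimately have "wilf_equivalent q q'" by (simp add: wilf_equivalent_def)
  moreover have "skew_connected (points q')"
    unfolding skew_connected_def
  proof (intro conjI allI impI)
    have conn: "skew_connected (points q)" using q(2) skew_indecomposable_iff_connected by blast
    then show "points q' \<noteq> {}" unfolding pq' skew_connected_def by blast
    fix S T assume ST: "points q' = S \<union> T" "northwest S T"
    \<comment> \<open>A northwest partition of the image pulls back to one of
      \<open>points q\<close> with its two sides exchanged.\<close>
    let ?pre = "\<lambda>S. {x \<in> points q. \<phi> k x \<in> S}"
    have "points q = ?pre T \<union> ?pre S" using ST(1) unfolding pq' by blast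
    moreover have "northwest (?pre T) (?pre S)"
      using nw[OF Q] ST(2) by (simp add: northwest_def)
    ultimately have "?pre T = {} \<or> ?pre S = {}"
      using conn unfolding skew_connected_def by blast
    moreover have "\<exists>x\<in>points q. y = \<phi> k x" if "y \<in> S \<union> T" for y
      using that unfolding ST(1)[symmetric] pq' by blast
    ultimately show "S = {} \<or> T = {}" by blast
  qed
  then have "skew_indecomposable q'" using skew_indecomposable_iff_connected by blast
  ultimately show thesis using that q' pq' by blast
qed

text \<open>The diagram of the inverse permutation is the reflection in the main diagonal, and an
  embedding is conjugated by that reflection.\<close>

lemma inverse_pattern:
  assumes "q \<in> permutations_of_set {1..k}" "skew_indecomposable q"
  obtains q' where "q' \<in> permutations_of_set {1..k}" "skew_indecomposable q'"
    "wilf_equivalent q q'" "points q' = prod.swap ` points q"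
proof (rule symmetric_pattern[where \<phi> = "\<lambda>_. prod.swap", OF _ _ _ _ assms])
  fix n P assume "P \<in> perm_points n"
  moreover have "card (prod.swap ` P) = card P" by (rule card_image) simp
  ultimately show "prod.swap ` P \<in> perm_points n"
    by (auto simp: perm_points_def inj_on_def)
next
  fix m n P Q assume "embeds Q P"
  then obtain g where "g ` Q \<subseteq> P"
     "\<And>x y. x \<in> Q \<Longrightarrow> y \<in> Q \<Longrightarrow> fst (g x) < fst (g y) \<longleftrightarrow> fst x < fst y"
     "\<And>x y. x \<in> Q \<Longrightarrow> y \<in> Q \<Longrightarrow> snd (g x) < snd (g y) \<longleftrightarrow> snd x < snd y"
    unfolding embeds_def by metis
  then show "embeds (prod.swap ` Q) (prod.swap ` P)"
    unfolding embeds_def by (intro exI[of _ "prod.swap \<circ> g \<circ> prod.swap"]) auto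
qed (auto simp: image_image northwest_def intro: that)

section \<open>The half-turn of the square\<close>

lemma reverse_complement_involution:
  assumes "x \<in> {1..n} \<times> {1..n}"
  shows "reverse_complement n (reverse_complement n x) = x"
  using assms by (cases x) (simp add: reverse_complement_def)

lemma reverse_complement_in_square:
  "x \<in> {1..n} \<times> {1..n} \<Longrightarrow> reverse_complement n x \<in> {1..n} \<times> {1..n}"
  by (auto simp: reverse_complement_def)

lemma reverse_complement_image_involution:
  assumes "P \<subseteq> {1..n} \<times> {1..n}"
  shows "reverse_complement n ` reverse_complement n ` P = P"
proof -
  have "(\<lambda>x. reverse_complement n (reverse_complement n x)) ` P = (\<lambda>x. x) ` P"
    using assms reverse_complement_involution by (intro image_cong refl) blast
  then show ?thesis by (simp add: image_image)
qed

lemma reverse_complement_less: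
  assumes "x \<in> {1..n} \<times> {1..n}" "y \<in> {1..n} \<times> {1..n}"
  shows "fst (reverse_complement n x) < fst (reverse_complement n y) \<longleftrightarrow> fst y < fst x"
    "snd (reverse_complement n x) < snd (reverse_complement n y) \<longleftrightarrow> snd y < snd x"
  using assms by (auto simp: reverse_complement_def)

lemma reverse_complement_pattern:
  assumes "q \<in> permutations_of_set {1..k}" "skew_indecomposable q"
  obtains q' where "q' \<in> permutations_of_set {1..k}" "skew_indecomposable q'"
    "wilf_equivalent q q'" "points q' = reverse_complement k ` points q"
proof (rule symmetric_pattern[where \<phi> = reverse_complement, OF _ _ _ _ assms])
  fix n P assume P: "P \<in> perm_points n"
  then have sub: "P \<subseteq> {1..n} \<times> {1..n}" by (simp add: perm_points_def)
  have inj: "inj_on (reverse_complement n) P"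
    using sub reverse_complement_involution by (metis inj_onI subsetD)
  have eqD: "fst (reverse_complement n x) = fst (reverse_complement n y) \<Longrightarrow> fst x = fst y"
    "snd (reverse_complement n x) = snd (reverse_complement n y) \<Longrightarrow> snd x = snd y"
    if xy: "x \<in> P" "y \<in> P" for x y
  proof -
    have "fst x \<le> n" "fst y \<le> n" "snd x \<le> n" "snd y \<le> n"
      using subsetD[OF sub xy(1)] subsetD[OF sub xy(2)] by (simp_all add: mem_Times_iff)
    then show "fst (reverse_complement n x) = fst (reverse_complement n y) \<Longrightarrow> fst x = fst y"
      "snd (reverse_complement n x) = snd (reverse_complement n y) \<Longrightarrow> snd x = snd y"
      unfolding reverse_complement_def by simp_all
  qed
  have P': "inj_on fst P" "inj_on snd P" using P by (auto simp: perm_points_def)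
  have fst_inj: "inj_on (fst \<circ> reverse_complement n) P"
  proof (rule inj_onI)
    fix x y assume "x \<in> P" "y \<in> P"
      "(fst \<circ> reverse_complement n) x = (fst \<circ> reverse_complement n) y"
    then show "x = y" using inj_onD[OF P'(1)] eqD(1) unfolding comp_def by blast
  qed
  have snd_inj: "inj_on (snd \<circ> reverse_complement n) P"
  proof (rule inj_onI)
    fix x y assume "x \<in> P" "y \<in> P"
      "(snd \<circ> reverse_complement n) x = (snd \<circ> reverse_complement n) y"
    then show "x = y" using inj_onD[OF P'(2)] eqD(2) unfolding comp_def by blast
  qed
  have "reverse_complement n ` P \<subseteq> {1..n} \<times> {1..n}"
    using sub reverse_complement_in_square by blast
  then show "reverse_complement n ` P \<in> perm_points n"
    using P inj inj_on_imageI[OF fst_inj] inj_on_imageI[OF snd_inj] by (simp add: perm_points_def card_image)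
  show "reverse_complement n ` reverse_complement n ` P = P"
    using sub by (rule reverse_complement_image_involution)
  fix x y assume xy: "x \<in> P" "y \<in> P"
    and "northwest {reverse_complement n x} {reverse_complement n y}"
  then show "northwest {y} {x}"
    unfolding northwest_def
    using reverse_complement_less[OF subsetD[OF sub xy(1)] subsetD[OF sub xy(2)]]
      reverse_complement_less[OF subsetD[OF sub xy(2)] subsetD[OF sub xy(1)]] by simp
next
  fix m n P Q assume P: "P \<in> perm_points n" and Q: "Q \<in> perm_points m" and "embeds Q P"
  then obtain g where g: "g ` Q \<subseteq> P"
     "\<And>x y. x \<in> Q \<Longrightarrow> y \<in> Q \<Longrightarrow> fst (g x) < fst (g y) \<longleftrightarrow> fst x < fst y"
     "\<And>x y. x \<in> Q \<Longrightarrow> y \<in> Q \<Longrightarrow> snd (g x) < snd (g y) \<longleftrightarrow> snd x < snd y"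
    unfolding embeds_def by metis
  have sub: "x \<in> {1..m} \<times> {1..m}" "g x \<in> {1..n} \<times> {1..n}" if "x \<in> Q" for x
    using P Q that g(1) unfolding perm_points_def by blast+
  \<comment> \<open>The embedding is conjugated by half-turns of two different squares, of side
    \<open>m\<close> for the pattern and \<open>n\<close> for the permutation.\<close>
  define h where "h = reverse_complement n \<circ> g \<circ> reverse_complement m"
  have h: "h (reverse_complement m x) = reverse_complement n (g x)" if "x \<in> Q" for x
    using reverse_complement_involution[OF sub(1)[OF that]] by (simp add: h_def)
  have "fst (h (reverse_complement m x)) < fst (h (reverse_complement m y)) \<longleftrightarrow>
      fst (reverse_complement m x) < fst (reverse_complement m y)"
    "snd (h (reverse_complement m x)) < snd (h (reverse_complement m y)) \<longleftrightarrow>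
      snd (reverse_complement m x) < snd (reverse_complement m y)"
    if xy: "x \<in> Q" "y \<in> Q" for x y
    unfolding h[OF xy(1)] h[OF xy(2)]
      reverse_complement_less[OF sub(1)[OF xy(1)] sub(1)[OF xy(2)]]
      reverse_complement_less[OF sub(2)[OF xy(1)] sub(2)[OF xy(2)]]
    using g(2,3) xy by simp_all
  moreover have "h ` reverse_complement m ` Q \<subseteq> reverse_complement n ` P"
    using g(1) h by auto
  ultimately show "embeds (reverse_complement m ` Q) (reverse_complement n ` P)"
    unfolding embeds_def by (intro exI[of _ h]) simp
qed (use that in blast)

text \<open>
  If the inverse of \<open>Q\<close> is bad, then removing its lowest point \<open>e\<close> leaves \<open>T\<close> northwest of \<open>S\<close>; if the
  reverse complement is bad, then removing the rightmost point \<open>g\<close> leaves \<open>R\<close> northwest of \<open>M\<close>. If both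
  hold, then \<open>e \<in> M\<close>, \<open>g \<in> S\<close> and \<open>R \<subseteq> T\<close>, so that \<open>R\<close> is northwest of everything else.
\<close>

lemma symmetry_without_split:
  assumes Q: "Q \<in> perm_points k" and conn: "skew_connected Q"
    and corner: "(1, 1) \<notin> Q \<or> (k, k) \<notin> Q"
  shows "(1, 1) \<notin> Q \<and> \<not> splits_after_first (prod.swap ` Q) \<or>
    (k, k) \<notin> Q \<and> \<not> splits_after_first (reverse_complement k ` Q)"
proof -
  have sub: "Q \<subseteq> {1..k} \<times> {1..k}" using Q by (simp add: perm_points_def)
  \<comment> \<open>Undoing the reflection turns the leftmost point into the lowest one and reverses
    the northwest relation.\<close>
  have swapE: "\<exists>e S T. Q = insert e (S \<union> T) \<and> S \<noteq> {} \<and> T \<noteq> {} \<and> northwest T S \<and>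
      (\<forall>x\<in>S \<union> T. snd e < snd x) \<and> (\<forall>x\<in>S. fst e < fst x)"
    if "splits_after_first (prod.swap ` Q)"
  proof -
    from that obtain f S T where *: "prod.swap ` Q = insert f (S \<union> T)" "S \<noteq> {}" "T \<noteq> {}"
      "northwest S T" "\<forall>x\<in>S \<union> T. fst f < fst x" "\<forall>x\<in>S. snd f < snd x"
      unfolding splits_after_first_def by blast
    have "prod.swap ` prod.swap ` Q = Q" by (simp add: image_image)
    then have "Q = insert (prod.swap f) (prod.swap ` S \<union> prod.swap ` T)"
      unfolding *(1) by (simp add: image_Un)
    moreover have "northwest (prod.swap ` T) (prod.swap ` S)"
      using *(4) by (simp add: northwest_def)
    moreover have "\<forall>x\<in>prod.swap ` S \<union> prod.swap ` T. snd (prod.swap f) < snd x"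
      "\<forall>x\<in>prod.swap ` S. fst (prod.swap f) < fst x"
      using *(5,6) by (simp_all add: ball_Un)
    ultimately show ?thesis using *(2,3) by blast
  qed
  \<comment> \<open>Undoing the half-turn turns the leftmost point into the rightmost one and
    reverses all comparisons.\<close>
  have rcE: "\<exists>g M R. Q = insert g (M \<union> R) \<and> M \<noteq> {} \<and> R \<noteq> {} \<and> northwest R M \<and>
      (\<forall>x\<in>M \<union> R. fst x < fst g) \<and> (\<forall>x\<in>M. snd x < snd g)"
    if "splits_after_first (reverse_complement k ` Q)"
  proof -
    let ?c = "reverse_complement k"
    from that obtain f S T where *: "?c ` Q = insert f (S \<union> T)" "S \<noteq> {}" "T \<noteq> {}"
      "northwest S T" "\<forall>x\<in>S \<union> T. fst f < fst x" "\<forall>x\<in>S. snd f < snd x"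
      unfolding splits_after_first_def by blast
    have "?c ` ?c ` Q = Q"
      using sub by (rule reverse_complement_image_involution)
    then have Qeq: "Q = insert (?c f) (?c ` S \<union> ?c ` T)"
      unfolding *(1) by (simp add: image_Un)
    have "?c ` Q \<subseteq> {1..k} \<times> {1..k}"
      using sub reverse_complement_in_square by blast
    then have in_square: "x \<in> {1..k} \<times> {1..k}" if "x \<in> insert f (S \<union> T)" for x
      using that unfolding *(1) by blast
    have less: "fst (?c x) < fst (?c y) \<longleftrightarrow> fst y < fst x" "snd (?c x) < snd (?c y) \<longleftrightarrow> snd y < snd x"
      if "x \<in> insert f (S \<union> T)" "y \<in> insert f (S \<union> T)" for x y
      using reverse_complement_less[OF in_square in_square, OF that] .
    have "northwest (?c ` T) (?c ` S)"
      using *(4) less unfolding northwest_def by blast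
    moreover have "\<forall>x\<in>?c ` S \<union> ?c ` T. fst x < fst (?c f)" "\<forall>x\<in>?c ` S. snd x < snd (?c f)"
      using *(5,6) less by blast+
    ultimately show ?thesis using Qeq *(2,3) by blast
  qed
  show ?thesis
  proof (cases "splits_after_first (prod.swap ` Q)")
    case True
    from swapE[OF this] obtain e S T where e: "Q = insert e (S \<union> T)" "S \<noteq> {}" "T \<noteq> {}"
      "northwest T S" "\<forall>x\<in>S \<union> T. snd e < snd x" "\<forall>x\<in>S. fst e < fst x" by blast
    have Qe: "x \<in> Q \<longleftrightarrow> x = e \<or> x \<in> S \<or> x \<in> T" for x unfolding e(1) by blast
    obtain s t where st: "s \<in> S" "t \<in> T" using e(2,3) by blast
    then have stQ: "s \<in> Q" "t \<in> Q" using Qe by blast+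
    have le: "fst x \<le> k \<and> snd x \<le> k" if "x \<in> Q" for x using sub that by auto
    \<comment> \<open>The top right corner cannot be \<open>e\<close>, which is below the others,
      nor in \<open>S\<close>, which is below \<open>T\<close>, nor in \<open>T\<close>, which is
      left of \<open>S\<close>.\<close>
    have "(k, k) \<notin> Q"
    proof
      assume "(k, k) \<in> Q"
      then consider "(k, k) = e" | "(k, k) \<in> S" | "(k, k) \<in> T" using e(1) by blast
      then show False
      proof cases
        case 1
        then have "k < snd s" using e(5) st(1) by force
        then show False using le[OF stQ(1)] by simp
      next
        case 2
        then have "k < snd t" using e(4) st(2) by (force simp: northwest_def)
        then show False using le[OF stQ(2)] by simp
      next
        case 3
        then have "k < fst s" using e(4) st(1) by (force simp: northwest_def)
        then show False using le[OF stQ(1)] by simp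
      qed
    qed
    moreover have "\<not> splits_after_first (reverse_complement k ` Q)"
    proof
      assume "splits_after_first (reverse_complement k ` Q)"
      from rcE[OF this] obtain g M R where g: "Q = insert g (M \<union> R)" "M \<noteq> {}" "R \<noteq> {}"
        "northwest R M" "\<forall>x\<in>M \<union> R. fst x < fst g" "\<forall>x\<in>M. snd x < snd g" by blast
      have Qg: "x \<in> Q \<longleftrightarrow> x = g \<or> x \<in> M \<or> x \<in> R" for x unfolding g(1) by blast
      obtain m where m: "m \<in> M" using g(2) by blast
      then have mQ: "m \<in> Q" using Qg by blast
      have right: "fst x \<le> fst g" if "x \<in> Q" for x
        using that g(5) unfolding g(1) by (auto intro: less_imp_le)
      have low: "snd e \<le> snd x" if "x \<in> Q" for x
        using that e(5) unfolding e(1) by (auto intro: less_imp_le)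
      \<comment> \<open>The point \<open>e\<close> is left of \<open>S\<close>, so it is not the
        rightmost point \<open>g\<close>; being lowest, it is not in \<open>R\<close>, which is
        above \<open>M\<close>.\<close>
      have "e \<noteq> g" using right[OF stQ(1)] bspec[OF e(6) st(1)] by auto
      moreover have "e \<notin> R"
      proof
        assume "e \<in> R"
        then have "snd m < snd e" using g(4) m by (auto simp: northwest_def)
        then show False using low[OF mQ] by simp
      qed
      ultimately have eM: "e \<in> M" using Qe[of e] Qg[of e] by blast
      have "g \<notin> T"
      proof
        assume "g \<in> T"
        then have "fst g < fst s" using e(4) st(1) by (auto simp: northwest_def)
        then show False using right[OF stQ(1)] by simp
      qed
      with \<open>e \<noteq> g\<close> have gS: "g \<in> S" using Qe[of g] Qg[of g] by blast
      \<comment> \<open>\<open>R\<close> lies to the left of \<open>e\<close>, because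
        \<open>e\<close> is in \<open>M\<close>, whereas \<open>S\<close> lies to its right.\<close>
      have "R \<subseteq> T"
      proof
        fix x assume x: "x \<in> R"
        then have "fst x < fst e" using g(4) eM by (auto simp: northwest_def)
        then have "x \<notin> S" "x \<noteq> e" using e(6) by force+
        then show "x \<in> T" using x Qe[of x] Qg[of x] by blast
      qed
      then have "northwest R (insert g M)"
        using g(4) e(4) gS by (auto simp: northwest_def)
      moreover have "Q = R \<union> insert g M" using g(1) by blast
      ultimately show False using conn g(3) unfolding skew_connected_def by blast
    qed
    ultimately show ?thesis by blast
  next
    case noswap: False
    show ?thesis
    proof (cases "(1, 1) \<in> Q")
      case True
      \<comment> \<open>Only the half-turn is available here. The bottom left corner cannot be
        \<open>g\<close>, which is right of the others, nor in \<open>M\<close>, which is right of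
        \<open>R\<close>, nor in \<open>R\<close>, which is above \<open>M\<close>.\<close>
      have "\<not> splits_after_first (reverse_complement k ` Q)"
      proof
        assume "splits_after_first (reverse_complement k ` Q)"
        from rcE[OF this] obtain g M R where g: "Q = insert g (M \<union> R)" "M \<noteq> {}" "R \<noteq> {}"
          "northwest R M" "\<forall>x\<in>M \<union> R. fst x < fst g" "\<forall>x\<in>M. snd x < snd g" by blast
        obtain m r where mr: "m \<in> M" "r \<in> R" using g(2,3) by blast
        then have mrQ: "m \<in> Q" "r \<in> Q" unfolding g(1) by blast+
        have ge: "1 \<le> fst x \<and> 1 \<le> snd x" if "x \<in> Q" for x using sub that by auto
        from True consider "(1, 1) = g" | "(1, 1) \<in> M" | "(1, 1) \<in> R" using g(1) by blast
        then show False
        proof cases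
          case 1
          then have "fst m < 1" using g(5) mr(1) by force
          then show False using ge[OF mrQ(1)] by simp
        next
          case 2
          then have "fst r < 1" using g(4) mr(2) by (force simp: northwest_def)
          then show False using ge[OF mrQ(2)] by simp
        next
          case 3
          then have "snd m < 1" using g(4) mr(1) by (force simp: northwest_def)
          then show False using ge[OF mrQ(1)] by simp
        qed
      qed
      then show ?thesis using corner True by blast
    next
      case False
      then show ?thesis using noswap by blast
    qed
  qed
qed

section \<open>Corners of the diagram and conclusion\<close>

lemma corner_iff_hd:
  assumes "q \<in> permutations_of_set {1..k}" "q \<noteq> []"
  shows "(1, 1) \<in> points q \<longleftrightarrow> hd q = 1"
  using assms by (auto simp: points_def hd_conv_nth)

lemma corner_iff_last:
  assumes "q \<in> permutations_of_set {1..k}" "q \<noteq> []"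
  shows "(k, k) \<in> points q \<longleftrightarrow> last q = k"
proof -
  have "length q = k" using assms(1) by (rule length_permutations_interval)
  then show ?thesis using assms(2) by (cases k) (auto simp: points_def last_conv_nth)
qed

text \<open>The merging injection may fail for \<open>q\<close> itself, so it is applied to a
  symmetric image of \<open>q\<close>. Wilf invariance of the counts for one and two blocks carries
  the inequality back.\<close>

lemma Av_blocks_2_le_1_corner:
  assumes q: "q \<in> permutations_of_set {1..k}" "skew_indecomposable q"
    and corner: "hd q \<noteq> 1 \<or> last q \<noteq> k"
  shows "Av_blocks n 2 q \<le> Av_blocks n 1 q"
proof -
  have "q \<noteq> []" using q(2) by (simp add: skew_indecomposable_def)
  have Q: "points q \<in> perm_points k" using q(1) points_image by blast
  have "\<exists>q'. q' \<in> permutations_of_set {1..k} \<and> skew_indecomposable q' \<and> wilf_equivalent q q' \<and>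
      (1, 1) \<notin> points q' \<and> \<not> splits_after_first (points q')"
  proof -
    have "(1, 1) \<notin> points q \<or> (k, k) \<notin> points q"
      using corner corner_iff_hd corner_iff_last q(1) \<open>q \<noteq> []\<close> by blast
    then consider
      "(1, 1) \<notin> points q" "\<not> splits_after_first (prod.swap ` points q)" |
      "(k, k) \<notin> points q" "\<not> splits_after_first (reverse_complement k ` points q)"
      using symmetry_without_split[OF Q] q(2) skew_indecomposable_iff_connected by blast
    then show ?thesis
    proof cases
      case 1
      from inverse_pattern[OF q] obtain q' where q': "q' \<in> permutations_of_set {1..k}"
        "skew_indecomposable q'" "wilf_equivalent q q'" "points q' = prod.swap ` points q" .
      \<comment> \<open>The reflection fixes the corner \<open>(1, 1)\<close>.\<close>
      have "(1, 1) \<notin> prod.swap ` points q" using 1(1) by auto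
      with 1(2) q' show ?thesis by (intro exI[of _ q'] conjI) simp_all
    next
      case 2
      from reverse_complement_pattern[OF q] obtain q' where q': "q' \<in> permutations_of_set {1..k}"
        "skew_indecomposable q'" "wilf_equivalent q q'"
        "points q' = reverse_complement k ` points q" .
      \<comment> \<open>The half-turn carries \<open>(k, k)\<close> to \<open>(1, 1)\<close>, so a
        pattern not ending in \<open>k\<close> becomes one not starting with 1.\<close>
      have "(1, 1) \<notin> reverse_complement k ` points q"
      proof
        assume "(1, 1) \<in> reverse_complement k ` points q"
        then obtain i a where ia: "(i, a) \<in> points q" "Suc k - i = 1" "Suc k - a = 1"
          by (auto simp: reverse_complement_def)
        then have "i = k" "a = k" by simp_all
        then show False using ia(1) 2(1) by blast
      qed
      with 2(2) q' show ?thesis by (intro exI[of _ q'] conjI) simp_all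
    qed
  qed
  then obtain q' where q': "q' \<in> permutations_of_set {1..k}" "skew_indecomposable q'"
    "wilf_equivalent q q'" "(1, 1) \<notin> points q'" "\<not> splits_after_first (points q')" by blast
  have ne: "q' \<noteq> []" using q'(2) by (simp add: skew_indecomposable_def)
  then have "hd q' \<noteq> 1" using q'(1,4) corner_iff_hd by blast
  then have "Av_blocks n 2 q' \<le> Av_blocks n 1 q'"
    using Av_blocks_2_le_1 q'(1,5) ne by blast
  then show ?thesis
    using wilf_Av_blocks_1[OF q(2) q'(2,3)] wilf_Av_blocks_2[OF q(2) q'(2,3)] by simp
qed

theorem theorem4p3:
  fixes q :: "nat list" and k n l :: nat
  assumes "q \<in> permutations_of_set {1..k}"
    and "skew_indecomposable q"
    and "hd q \<noteq> 1 \<or> last q \<noteq> k \<or>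
         (hd q = 1 \<and> last q = k \<and>
          (\<exists>q' \<in> permutations_of_set {1..k}.
             skew_indecomposable q' \<and> wilf_equivalent q q' \<and> (hd q' \<noteq> 1 \<or> last q' \<noteq> k)))"
    and "l \<ge> 1"
  shows "Av_blocks n (l + 1) q \<le> Av_blocks n l q"
proof (rule Av_blocks_antimono[OF assms(2) _ assms(4)])
  fix n
  show "Av_blocks n 2 q \<le> Av_blocks n 1 q"
  proof (cases "hd q \<noteq> 1 \<or> last q \<noteq> k")
    case True
    then show ?thesis using Av_blocks_2_le_1_corner assms(1,2) by blast
  next
    \<comment> \<open>Here the inequality is proved for the Wilf-equivalent pattern
      \<open>q'\<close> and transferred to \<open>q\<close>.\<close>
    case False
    then obtain q' where q': "q' \<in> permutations_of_set {1..k}" "skew_indecomposable q'"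
      "wilf_equivalent q q'" "hd q' \<noteq> 1 \<or> last q' \<noteq> k"
      using assms(3) by blast
    then show ?thesis
      using Av_blocks_2_le_1_corner[OF q'(1,2,4), of n]
        wilf_Av_blocks_1[OF assms(2) q'(2,3)] wilf_Av_blocks_2[OF assms(2) q'(2,3)] by simp
  qed
qed

end
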